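(* Let $\mathcal{X},\mathcal{Y}$ be Banach spaces, let $G:\mathcal{X}\to\mathcal{Y}$ be a continuous and Fréchet-differentiable (nonlinear) operator, let $g,g^\delta\in\mathcal{Y}$ (exact and noisy data), let $F_{g^\delta}:\mathcal{Y}\to\mathbb{R}\cup\{+\infty\}$ be a data fidelity such that $F_{g^\delta}\circ G$ is Fréchet-differentiable, and let $R:\mathcal{X}\to\mathbb{R}\cup\{+\infty\}$ be convex. Let $\widetilde v\in\mathcal{X}$ be the exact solution of the inverse problem $G(v)=g$, i.e. $G(\widetilde v)=g$, and suppose the source condition holds: there exist $\rho\in\partial R(\widetilde v)$ and $q\in\mathcal{Y}^*\setminus\{0\}$ with $$\rho=G'(\widetilde v)^*q .$$ Furthermore, suppose that for this $q$ and a constant $C$ the nonlinearity condition $$\langle q,\,G(v)-G(w)-G'(w)(v-w)\rangle\le C\,\|q\|_{\mathcal{Y}^*}\,\|G(v)-G(w)\|_{\mathcal{Y}}\qquad\text{for all } v,w\in\mathcal{X}$$ holds. If, for $\alpha>0$, there exists a minimizer $\hat v$ of $$\min_{v\in\mathcal{X}}\ F_{g^\delta}(G(v))+\alpha R(v)$$ which satisfies the KKT optimality conditions, then $$F_{g^\delta}(G(\hat v))+\alpha D_R^{\rho}(\hat v,\widetilde v)\le F_{g^\delta}(g)+\alpha(C+1)\,\|q\|_{\mathcal{Y}^*}\,\|G(\hat v)-G(\widetilde v)\|_{\mathcal{Y}} .$$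
   Context: $\partial R(\widetilde v)\subset\mathcal{X}^*$ is the subdifferential of the convex functional $R$ at $\widetilde v$; $G'$ is the Fréchet derivative of $G$, and $G'(\widetilde v)^*:\mathcal{Y}^*\to\mathcal{X}^*$ is the adjoint of $G'(\widetilde v)$; $\langle\cdot,\cdot\rangle$ denotes the duality pairing. For $\rho\in\partial R(\widetilde v)$ the Bregman distance is $$D_R^{\rho}(\hat v,\widetilde v)=R(\hat v)-R(\widetilde v)-\langle\rho,\hat v-\widetilde v\rangle .$$ The KKT optimality conditions for a minimizer $\hat v$ of $F_{g^\delta}(G(v))+\alpha R(v)$ mean that there exists $p\in\partial R(\hat v)$ with $(F_{g^\delta}\circ G)'(\hat v)+\alpha p=0$. *)

theory Defs
  imports "HOL-Analysis.Analysis"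
begin

text \<open>
  Functionals with values in \<open>\<real> \<union> {+\<infinity>}\<close> are maps into \<^typ>\<open>ereal\<close> that avoid \<open>-\<infinity>\<close>.
  The dual space of \<open>'a\<close> is \<open>'a \<Rightarrow>\<^sub>L real\<close>; its norm is the operator norm, and application
  is the duality pairing.
\<close>

definition ereal_convex :: "('a::real_vector \<Rightarrow> ereal) \<Rightarrow> bool" where
  "ereal_convex R \<longleftrightarrow>
     (\<forall>v w. \<forall>t\<in>{0..1::real}. R ((1 - t) *\<^sub>R v + t *\<^sub>R w) \<le> ereal (1 - t) * R v + ereal t * R w)"

text \<open>As usual, the subdifferential is empty outside the effective domain.\<close>

definition subdifferential ::
  "('a::real_normed_vector \<Rightarrow> ereal) \<Rightarrow> 'a \<Rightarrow> ('a \<Rightarrow>\<^sub>L real) set" where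
  "subdifferential R v =
     {p. \<bar>R v\<bar> \<noteq> \<infinity> \<and> (\<forall>w. R v + ereal (blinfun_apply p (w - v)) \<le> R w)}"

definition bregman_distance ::
  "('a::real_normed_vector \<Rightarrow> ereal) \<Rightarrow> ('a \<Rightarrow>\<^sub>L real) \<Rightarrow> 'a \<Rightarrow> 'a \<Rightarrow> ereal" where
  "bregman_distance R \<rho> v w = R v - R w - ereal (blinfun_apply \<rho> (v - w))"

definition dual_adjoint ::
  "('a::real_normed_vector \<Rightarrow>\<^sub>L 'b::real_normed_vector) \<Rightarrow> ('b \<Rightarrow>\<^sub>L real) \<Rightarrow> ('a \<Rightarrow>\<^sub>L real)" where
  "dual_adjoint A q = q o\<^sub>L A"

text \<open>
  Differentiability of an extended-real-valued map at \<open>v\<close> includes finiteness near \<open>v\<close>;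
  without it \<^const>\<open>real_of_ereal\<close> would silently turn infinite values into \<open>0\<close>.
\<close>

definition has_ereal_frechet_derivative ::
  "('a::real_normed_vector \<Rightarrow> ereal) \<Rightarrow> ('a \<Rightarrow>\<^sub>L real) \<Rightarrow> 'a \<Rightarrow> bool" where
  "has_ereal_frechet_derivative f D v \<longleftrightarrow>
     (\<forall>\<^sub>F u in nhds v. \<bar>f u\<bar> \<noteq> \<infinity>) \<and>
     ((\<lambda>u. real_of_ereal (f u)) has_derivative blinfun_apply D) (at v)"

definition ereal_frechet_differentiable :: "('a::real_normed_vector \<Rightarrow> ereal) \<Rightarrow> bool" where
  "ereal_frechet_differentiable f \<longleftrightarrow> (\<forall>v. \<exists>D. has_ereal_frechet_derivative f D v)"

text \<open>
  Optimality conditions for minimizing \<open>f + \<alpha> R\<close>, where \<open>D\<close> is the (unique) derivative of \<open>f\<close>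
  at \<open>v\<close>.
\<close>

definition KKT_conditions ::
  "('a::real_normed_vector \<Rightarrow> ereal) \<Rightarrow> real \<Rightarrow> ('a \<Rightarrow> ereal) \<Rightarrow> 'a \<Rightarrow> bool" where
  "KKT_conditions f \<alpha> R v \<longleftrightarrow>
     (\<exists>D. has_ereal_frechet_derivative f D v \<and> (\<exists>p \<in> subdifferential R v. D + \<alpha> *\<^sub>R p = 0))"

end

theory Submission
  imports Defs
begin

text \<open>
  Comparing the minimizer with the exact solution cancels \<open>R\<close> from the Bregman distance and
  leaves the term \<open>-\<alpha> \<rho> (v\<^sub>m - v\<^sub>e)\<close>. By the source condition this is
  \<open>-\<alpha> q (G' v\<^sub>e (v\<^sub>m - v\<^sub>e))\<close>, that is, \<open>\<alpha> q\<close> applied to the linearization error of \<open>G\<close> at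
  \<open>v\<^sub>e\<close> minus \<open>\<alpha> q (G v\<^sub>m - G v\<^sub>e)\<close>.
\<close>

text \<open>The filter \<open>nhds v\<close> is not punctured, so finiteness near \<open>v\<close>
  includes finiteness at \<open>v\<close> itself.\<close>

lemma ereal_frechet_differentiable_finite:
  assumes "ereal_frechet_differentiable f"
  shows "\<bar>f v\<bar> \<noteq> \<infinity>"
proof -
  have "\<forall>\<^sub>F u in nhds v. \<bar>f u\<bar> \<noteq> \<infinity>"
    using assms
    unfolding ereal_frechet_differentiable_def has_ereal_frechet_derivative_def by blast
  then show ?thesis
    by (rule eventually_nhds_x_imp_x)
qed

lemma minus_blinfun_apply_le_norm: "- blinfun_apply q x \<le> norm q * norm x"
  using norm_blinfun[of q x] by simp

theorem theorem4:
  fixes G :: "'x::banach \<Rightarrow> 'y::banach"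
    and G' :: "'x \<Rightarrow> ('x \<Rightarrow>\<^sub>L 'y)"
    and g g\<^sub>\<delta> :: 'y
    and F :: "'y \<Rightarrow> 'y \<Rightarrow> ereal"
    and R :: "'x \<Rightarrow> ereal"
    and v\<^sub>e v\<^sub>m :: 'x
    and \<rho> :: "'x \<Rightarrow>\<^sub>L real"
    and q :: "'y \<Rightarrow>\<^sub>L real"
    and C \<alpha> :: real
  assumes G_cont: "continuous_on UNIV G"
    and G_diff: "\<And>v. (G has_derivative blinfun_apply (G' v)) (at v)"
    and F_range: "\<And>y. F g\<^sub>\<delta> y \<noteq> -\<infinity>"
    and FG_diff: "ereal_frechet_differentiable (F g\<^sub>\<delta> \<circ> G)"
    and R_range: "\<And>v. R v \<noteq> -\<infinity>"
    and R_convex: "ereal_convex R"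
    and exact: "G v\<^sub>e = g"
    and rho: "\<rho> \<in> subdifferential R v\<^sub>e"
    and q_nonzero: "q \<noteq> 0"
    and source: "\<rho> = dual_adjoint (G' v\<^sub>e) q"
    and nonlinearity: "\<And>v w. blinfun_apply q (G v - G w - blinfun_apply (G' w) (v - w))
                          \<le> C * norm q * norm (G v - G w)"
    and alpha_pos: "\<alpha> > 0"
    and minimizer: "is_arg_min (\<lambda>v. F g\<^sub>\<delta> (G v) + ereal \<alpha> * R v) (\<lambda>v. True) v\<^sub>m"
    and KKT: "KKT_conditions (F g\<^sub>\<delta> \<circ> G) \<alpha> R v\<^sub>m"
  shows "F g\<^sub>\<delta> (G v\<^sub>m) + ereal \<alpha> * bregman_distance R \<rho> v\<^sub>m v\<^sub>e
           \<le> F g\<^sub>\<delta> g + ereal (\<alpha> * (C + 1) * norm q * norm (G v\<^sub>m - G v\<^sub>e))"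
proof -
  \<comment> \<open>Once the four values of the functionals are known to be finite, the claim
    becomes an inequality between reals.\<close>
  have fin: "\<bar>F g\<^sub>\<delta> (G v)\<bar> \<noteq> \<infinity>" for v
    using ereal_frechet_differentiable_finite[OF FG_diff, of v] by simp
  obtain a where a: "F g\<^sub>\<delta> (G v\<^sub>m) = ereal a"
    using fin[of v\<^sub>m] by auto
  \<comment> \<open>Finiteness is known only on the range of \<open>G\<close>, which contains
    \<open>g\<close> because \<open>v\<^sub>e\<close> is an exact solution.\<close>
  obtain b where b: "F g\<^sub>\<delta> g = ereal b"
    using fin[of v\<^sub>e] exact by auto
  \<comment> \<open>KKT supplies a subgradient at \<open>v\<^sub>m\<close>, and subgradients exist
    only where \<open>R\<close> is finite.\<close>
  obtain r where r: "R v\<^sub>m = ereal r"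
    using KKT unfolding KKT_conditions_def subdifferential_def by auto
  obtain s where s: "R v\<^sub>e = ereal s"
    using rho unfolding subdifferential_def by auto
  have "F g\<^sub>\<delta> (G v\<^sub>m) + ereal \<alpha> * R v\<^sub>m \<le> F g\<^sub>\<delta> (G v\<^sub>e) + ereal \<alpha> * R v\<^sub>e"
    using minimizer unfolding is_arg_min_linorder by blast
  then have min: "a + \<alpha> * r \<le> b + \<alpha> * s"
    by (simp add: exact a b r s)
  have "- blinfun_apply \<rho> (v\<^sub>m - v\<^sub>e)
      = blinfun_apply q (G v\<^sub>m - G v\<^sub>e - blinfun_apply (G' v\<^sub>e) (v\<^sub>m - v\<^sub>e))
        - blinfun_apply q (G v\<^sub>m - G v\<^sub>e)"
    by (simp add: source dual_adjoint_def blinfun.diff_right)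
  \<comment> \<open>The nonlinearity condition at \<open>v\<^sub>m\<close>, \<open>v\<^sub>e\<close>
    contributes the constant \<open>C\<close>; the operator norm bound on the remaining term
    contributes the \<open>1\<close>.\<close>
  also have "\<dots> \<le> (C + 1) * norm q * norm (G v\<^sub>m - G v\<^sub>e)"
    using nonlinearity[of v\<^sub>m v\<^sub>e] minus_blinfun_apply_le_norm[of q "G v\<^sub>m - G v\<^sub>e"]
    by (simp add: algebra_simps)
  finally have "\<alpha> * - blinfun_apply \<rho> (v\<^sub>m - v\<^sub>e)
      \<le> \<alpha> * ((C + 1) * norm q * norm (G v\<^sub>m - G v\<^sub>e))"
    using alpha_pos by (intro mult_left_mono) auto
  with min have "a + \<alpha> * (r - s - blinfun_apply \<rho> (v\<^sub>m - v\<^sub>e))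
      \<le> b + \<alpha> * (C + 1) * norm q * norm (G v\<^sub>m - G v\<^sub>e)"
    by (simp add: algebra_simps)
  then show ?thesis
    by (simp add: bregman_distance_def a b r s)
qed

end
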